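(* For infinitely many positive integers $n$ there is a totally positive algebraic integer of degree $n$ and trace less than $$2n-\frac14\,\frac{\log\log n}{\log\log\log n}.$$
   Context: An algebraic integer is totally positive if all its conjugates over $\mathbb{Q}$ are real and positive. Its degree and trace are the degree of its minimal polynomial over $\mathbb{Q}$ and the sum of the zeros of that minimal polynomial, respectively. $\log$ is the natural logarithm. *)

theory Defs
  imports "HOL-Computational_Algebra.Computational_Algebra"
begin

abbreviation cpoly :: "rat poly \<Rightarrow> complex poly" where
  "cpoly \<equiv> map_poly of_rat"

definition min_poly :: "complex \<Rightarrow> rat poly" where
  "min_poly x = (THE p. lead_coeff p = 1 \<and> irreducible p \<and> poly (cpoly p) x = 0)"

definition conjugates :: "complex \<Rightarrow> complex set" where
  "conjugates x = {z. poly (cpoly (min_poly x)) z = 0}"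

definition totally_positive :: "complex \<Rightarrow> bool" where
  "totally_positive x \<longleftrightarrow> algebraic_int x \<and> (\<forall>z\<in>conjugates x. z \<in> \<real> \<and> Re z > 0)"

definition alg_degree :: "complex \<Rightarrow> nat" where
  "alg_degree x = degree (min_poly x)"

(* The multiset of zeros; min_poly x is separable, so for algebraic x
   this is the same as summing over the set conjugates x. *)
definition alg_trace :: "complex \<Rightarrow> complex" where
  "alg_trace x = sum_mset (proots (cpoly (min_poly x)))"

lemma cpoly_add: "cpoly (p + q) = cpoly p + cpoly q"
  by (intro poly_eqI) (simp add: coeff_map_poly of_rat_add)

lemma cpoly_mult: "cpoly (p * q) = cpoly p * cpoly q"
  by (intro poly_eqI) (simp add: coeff_map_poly coeff_mult of_rat_sum of_rat_mult)

lemma poly_cpoly_const: "poly (cpoly [:c:]) x = of_rat c"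
  by (simp add: map_poly_pCons)

(* min_poly is well defined on algebraic numbers *)
lemma ex1_min_poly:
  assumes "algebraic x"
  shows "\<exists>!p. lead_coeff p = 1 \<and> irreducible p \<and> poly (cpoly p) x = 0"
proof -
  obtain P where P: "\<forall>i. coeff P i \<in> \<rat>" "P \<noteq> 0" "poly P x = 0"
    using assms by (auto simp: algebraic_altdef)
  from P(1) obtain Q where Q: "P = cpoly Q"
    by (metis ratpolyE)
  have ex: "\<exists>p. p \<noteq> 0 \<and> poly (cpoly p) x = 0"
    using P(2,3) unfolding Q by (metis map_poly_0)
  then obtain p where p: "p \<noteq> 0 \<and> poly (cpoly p) x = 0" by blast
  obtain m where m: "m \<noteq> 0" "poly (cpoly m) x = 0"
    and least: "\<And>q. q \<noteq> 0 \<Longrightarrow> poly (cpoly q) x = 0 \<Longrightarrow> degree m \<le> degree q"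
    using ex_has_least_nat[of "\<lambda>p. p \<noteq> 0 \<and> poly (cpoly p) x = 0", OF p, of degree] by blast
  have dvd: "m dvd q" if "poly (cpoly q) x = 0" for q
  proof -
    have "poly (cpoly (q div m * m + q mod m)) x = 0"
      using that by simp
    then have "poly (cpoly (q mod m)) x = 0"
      unfolding cpoly_add cpoly_mult using m(2) by simp
    then have "q mod m = 0"
      using least[of "q mod m"] degree_mod_less[of m q] m(1) by linarith
    then show ?thesis by (simp add: mod_eq_0_iff_dvd)
  qed
  have nunit: "\<not> is_unit m"
    using m by (auto simp: is_unit_poly_iff poly_cpoly_const)
  have irr: "irreducible m"
  proof (rule irreducibleI)
    fix a b assume ab: "m = a * b"
    have "poly (cpoly a) x = 0 \<or> poly (cpoly b) x = 0"
      using m(2) unfolding ab cpoly_mult by simp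
    then have "m dvd a \<or> m dvd b" using dvd by blast
    then show "is_unit a \<or> is_unit b"
      using m(1) unfolding ab by (metis dvd_mult_cancel_left dvd_mult_cancel_right
        mult.right_neutral mult.left_neutral mult_eq_0_iff)
  qed (use m nunit in auto)
  define n where "n = smult (inverse (lead_coeff m)) m"
  have "lead_coeff n = 1" using m(1) by (simp add: n_def)
  moreover have "poly (cpoly n) x = 0"
    using m(2) by (simp add: n_def map_poly_smult of_rat_mult)
  moreover have "irreducible n"
    using irr m(1) irreducible_mult_unit_left[of "[:inverse (lead_coeff m):]" m]
    by (simp add: n_def is_unit_pCons_iff)
  moreover have "p = n" if p: "lead_coeff p = 1" "irreducible p" "poly (cpoly p) x = 0" for p
  proof -
    from dvd[OF p(3)] obtain k where k: "p = m * k" by blast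
    with p(2) nunit have "is_unit k" by (blast dest: irreducibleD)
    then obtain c where c: "k = [:c:]" by (auto simp: is_unit_poly_iff)
    have "lead_coeff m * c = 1" using p(1) by (auto simp: k c mult.commute split: if_splits)
    then show ?thesis using m(1) by (simp add: k c n_def inverse_unique)
  qed
  ultimately show ?thesis by blast
qed

end

theory Submission
  imports
    Defs
    "HOL-Computational_Algebra.Field_as_Ring"
    "HOL-Real_Asymp.Real_Asymp"
begin

text \<open>
  A monic integer polynomial \<open>P\<close> of degree 40 and trace 79 is exhibited such that \<open>f = P / x ^ 8\<close>
  alternates between values \<open>\<ge> 2\<close> and \<open>\<le> - 2\<close> at 41 positive points. Hence every value in \<open>(- 2, 2)\<close>
  has 40 distinct positive preimages under \<open>f\<close>, and the numerator of \<open>T\<^sub>n(f)\<close>, where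
  \<open>T\<^sub>n(2 cos t) = 2 cos (n t)\<close>, is a monic integer polynomial with \<open>40 n\<close> simple positive roots and
  trace \<open>79 n\<close>. The deficit \<open>2 \<cdot> degree - trace\<close> is thus linear in the degree. It is additive over
  irreducible factors, and only finitely many factors of bounded degree can occur, as all roots are
  bounded. So factors of arbitrarily large degree have a deficit linear in their degree, which is
  far more than \<open>log log n / log log log n\<close>.
\<close>

section \<open>Minimal polynomials and conjugacy classes\<close>

lemma degree_cpoly [simp]: "degree (cpoly p) = degree p"
  by (rule degree_map_poly) simp

lemma cpoly_eq_0_iff [simp]: "cpoly p = 0 \<longleftrightarrow> p = 0"
  by (auto simp: poly_eq_iff coeff_map_poly)

lemma min_poly_properties:
  assumes "algebraic x"
  shows "lead_coeff (min_poly x) = 1" "irreducible (min_poly x)" "poly (cpoly (min_poly x)) x = 0"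
  using theI'[OF ex1_min_poly[OF assms]] unfolding min_poly_def by blast+

lemma min_poly_eqI:
  assumes "lead_coeff p = 1" "irreducible p" "poly (cpoly p) x = 0"
  shows "min_poly x = p"
proof -
  have "cpoly p \<noteq> 0"
    using assms(1) by auto
  then have "algebraic x"
    using assms(3) by (auto simp: algebraic_altdef coeff_map_poly intro!: exI[of _ "cpoly p"])
  from ex1_min_poly[OF this] assms show ?thesis
    unfolding min_poly_def by (intro the1_equality) auto
qed

text \<open>Otherwise the two polynomials would be coprime over the rationals, and a Bezout identity
  evaluated at \<open>x\<close> would read 0 = 1.\<close>

lemma irreducible_dvd_of_common_root:
  fixes p q :: "rat poly"
  assumes "irreducible p" "poly (cpoly p) x = 0" "poly (cpoly q) x = 0"
  shows "p dvd q"
proof (rule ccontr)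
  assume "\<not> p dvd q"
  then have "coprime p q"
    by (rule prime_elem_imp_coprime[OF irreducible_imp_prime_elem_gcd[OF assms(1)]])
  then obtain a b where "a * p + b * q = 1"
    by (metis bezout_coefficients_fst_snd coprime_iff_gcd_eq_1)
  then have "poly (cpoly (a * p + b * q)) x = 1"
    by simp
  then show False
    by (simp add: cpoly_add cpoly_mult assms)
qed

lemma lead_coeff_cpoly: "lead_coeff (cpoly p) = of_rat (lead_coeff p)"
  by (simp add: coeff_map_poly)

text \<open>The support, taken with multiplicity one, sits inside \<open>M\<close>; equal sizes
  leave no room for a repeated element.\<close>

lemma mset_set_set_mset:
  assumes "size M = card (set_mset M)"
  shows "mset_set (set_mset M) = M"
proof -
  have "mset_set (set_mset M) \<subseteq># M"
    by (rule mset_set_set_mset_msubset)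
  moreover have "size (mset_set (set_mset M)) = size M"
    by (simp add: assms)
  ultimately show ?thesis
    by (metis mset_subset_size subset_mset.order_iff_strict less_irrefl)
qed

text \<open>Degrees add over a product, while numbers of distinct roots are subadditive and bounded
  by the degrees. If the product attains its bound, so does each factor.\<close>

lemma card_roots_factor:
  fixes p :: "complex poly"
  assumes "p dvd q" "q \<noteq> 0" "card {z. poly q z = 0} = degree q"
  shows "card {z. poly p z = 0} = degree p"
proof -
  obtain k where k: "q = p * k"
    using assms(1) by blast
  then have nz: "p \<noteq> 0" "k \<noteq> 0"
    using assms(2) by auto
  have "{z. poly q z = 0} = {z. poly p z = 0} \<union> {z. poly k z = 0}"
    by (auto simp: k)
  then have "degree q \<le> card {z. poly p z = 0} + card {z. poly k z = 0}"
    by (metis assms(3) card_Un_le)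
  moreover have "degree q = degree p + degree k"
    using nz by (simp add: k degree_mult_eq)
  ultimately show ?thesis
    using card_poly_roots_bound[OF nz(1)] card_poly_roots_bound[OF nz(2)] by linarith
qed

lemma proots_eq_mset_set:
  fixes p :: "complex poly"
  assumes "p \<noteq> 0" "card {z. poly p z = 0} = degree p"
  shows "proots p = mset_set {z. poly p z = 0}"
  using mset_set_set_mset[of "proots p"] assms by (simp add: size_proots_complex)

text \<open>The fibres of \<open>min_poly\<close> are conjugacy classes, so a sum over roots can be
  grouped by minimal polynomial.\<close>

lemma min_poly_eq_iff_conjugate:
  assumes "algebraic z" "algebraic w"
  shows "min_poly w = min_poly z \<longleftrightarrow> w \<in> conjugates z"
  using min_poly_properties[OF assms(1)] min_poly_properties[OF assms(2)] min_poly_eqI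
  unfolding conjugates_def by (metis mem_Collect_eq)

section \<open>Gauss's lemma and finiteness\<close>

text \<open>The target field is left generic: one integer polynomial is read over the rationals for
  divisibility, over the reals for sign changes and over the complex numbers for roots.\<close>

abbreviation int_poly_of :: "int poly \<Rightarrow> 'a::field_char_0 poly" where
  "int_poly_of \<equiv> map_poly of_int"

lemma int_poly_of_mult: "int_poly_of (p * q) = int_poly_of p * int_poly_of q"
  by (intro poly_eqI) (simp add: coeff_map_poly coeff_mult)

lemma int_poly_of_diff: "int_poly_of (p - q) = int_poly_of p - int_poly_of q"
  by (intro poly_eqI) (simp add: coeff_map_poly)

lemma int_poly_of_smult: "int_poly_of (smult c p) = smult (of_int c) (int_poly_of p)"
  by (intro poly_eqI) (simp add: coeff_map_poly)

lemma degree_int_poly_of [simp]: "degree (int_poly_of p) = degree p"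
  by (rule degree_map_poly) simp

lemma int_poly_of_inj: "int_poly_of p = int_poly_of q \<Longrightarrow> p = q"
  by (auto simp: poly_eq_iff coeff_map_poly)

lemma int_poly_of_eq_0_iff [simp]: "int_poly_of p = 0 \<longleftrightarrow> p = 0"
  by (auto simp: poly_eq_iff coeff_map_poly)

lemma cpoly_int_poly_of [simp]: "cpoly (int_poly_of p) = int_poly_of p"
  by (simp add: map_poly_map_poly o_def)

text \<open>A common denominator is built up coefficient by coefficient; then the content of the
  resulting integer polynomial is split off.\<close>

lemma rat_poly_primitive_multiple:
  fixes p :: "rat poly"
  assumes "p \<noteq> 0"
  obtains a :: rat and p' :: "int poly" where "p = smult a (int_poly_of p')" "content p' = 1"
proof -
  obtain q :: "int poly" and b :: int where q: "b \<noteq> 0" "smult (of_int b) p = int_poly_of q"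
  proof -
    have "\<exists>b. b \<noteq> 0 \<and> (\<exists>q. smult (of_int b) p = int_poly_of q)"
    proof (induction p)
      case 0
      show ?case by (intro exI[of _ 1]) (auto intro!: exI[of _ 0])
    next
      case (pCons c p)
      then obtain b q where b: "b \<noteq> 0" "smult (of_int b) p = int_poly_of q"
        by blast
      obtain n d where c: "c = of_int n / of_int d" "d \<noteq> (0::int)"
        by (metis Fract_of_int_quotient Rat_cases less_irrefl)
      have "smult (of_int (b * d)) (pCons c p) = int_poly_of (pCons (b * n) (smult d q))"
        using c b by (simp add: map_poly_pCons int_poly_of_smult mult.commute
            flip: b(2))
      then show ?case
        using b c by (intro exI[of _ "b * d"]) auto
    qed
    then show ?thesis
      using that by blast
  qed
  have "q \<noteq> 0"
    using q assms by (auto simp: map_poly_0)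
  have "int_poly_of q = smult (of_int (content q)) (int_poly_of (primitive_part q) :: rat poly)"
    by (metis content_times_primitive_part int_poly_of_smult)
  moreover have "p = smult (inverse (of_int b)) (smult (of_int b) p)"
    using q(1) by simp
  ultimately have "p = smult (inverse (of_int b) * of_int (content q)) (int_poly_of (primitive_part q))"
    by (simp only: q smult_smult)
  then show ?thesis
    using that \<open>q \<noteq> 0\<close> by (metis content_primitive_part)
qed

lemma content_monic_int:
  fixes p :: "int poly"
  assumes "lead_coeff p = 1"
  shows "content p = 1"
  by (metis assms content_dvd_coeff is_unit_content_iff)

text \<open>Gauss's lemma: both factors are rescaled to primitive integer polynomials, whose product
  is again primitive. Comparing contents shows that this product is \<open>A\<close> up to
  sign.\<close>

lemma monic_factor_int_coeffs:
  fixes p :: "rat poly" and A :: "int poly"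
  assumes "p dvd int_poly_of A" "lead_coeff p = 1" "lead_coeff A = 1"
  obtains p' where "p = int_poly_of p'"
proof -
  obtain k where k: "int_poly_of A = p * k"
    using assms(1) by blast
  have "A \<noteq> 0"
    using assms(3) by auto
  then have "p * k \<noteq> 0"
    by (simp flip: k)
  then have "p \<noteq> 0" "k \<noteq> 0"
    by auto
  obtain a p' where p': "p = smult a (int_poly_of p')" "content p' = 1"
    using rat_poly_primitive_multiple \<open>p \<noteq> 0\<close> by blast
  obtain b k' where k': "k = smult b (int_poly_of k')" "content k' = 1"
    using rat_poly_primitive_multiple \<open>k \<noteq> 0\<close> by blast
  have c1: "content (p' * k') = 1"
    using p' k' by (simp add: content_mult)
  obtain n d where nd: "a * b = of_int n / of_int d" "d \<noteq> (0::int)"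
    by (metis Fract_of_int_quotient Rat_cases less_irrefl)
  have "int_poly_of (smult d A) = (int_poly_of (smult n (p' * k')) :: rat poly)"
    using nd by (simp add: int_poly_of_smult int_poly_of_mult k p' k' field_simps)
  then have "smult d A = smult n (p' * k')"
    by (rule int_poly_of_inj)
  then have "content (smult d A) = content (smult n (p' * k'))"
    by simp
  then have "\<bar>d\<bar> = \<bar>n\<bar>"
    using c1 content_monic_int[OF assms(3)] by (simp add: abs_mult)
  then have A: "A = p' * k' \<or> A = - (p' * k')"
    using \<open>smult d A = smult n (p' * k')\<close> nd(2)
    by (metis abs_eq_iff minus_minus smult_cancel smult_minus_left smult_minus_right)
  then have "lead_coeff p' * lead_coeff k' = 1 \<or> - (lead_coeff p' * lead_coeff k') = 1"
    using assms(3) by (auto simp: lead_coeff_mult)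
  \<comment> \<open>The leading coefficient is an integer unit, so monicity of \<open>p\<close>
    forces the scalar \<open>a\<close> to be 1 or -1.\<close>
  then have "lead_coeff p' dvd 1"
    by (metis dvd_triv_left dvd_minus_iff)
  then have "lead_coeff p' = 1 \<or> lead_coeff p' = - 1"
    by auto
  moreover have "a * of_int (lead_coeff p') = 1"
    using assms(2) by (simp add: p' coeff_map_poly split: if_splits)
  ultimately have "a = 1 \<or> a = - 1"
    by auto
  then have "p = int_poly_of p' \<or> p = int_poly_of (- p')"
    using p' by (auto simp: poly_eq_iff coeff_map_poly)
  then show ?thesis
    using that by blast
qed

text \<open>Each linear factor enlarges a common bound for all coefficients by a factor of at most
  \<open>1 + C\<close>.\<close>

lemma norm_coeff_prod_linear_le:
  fixes M :: "complex multiset"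
  assumes "\<And>x. x \<in># M \<Longrightarrow> norm x \<le> C"
  shows "norm (coeff (\<Prod>x\<in>#M. [:- x, 1:]) i) \<le> (1 + C) ^ size M"
  using assms
proof (induction M arbitrary: i)
  case empty
  show ?case by (simp add: coeff_1)
next
  case (add a M)
  let ?p = "\<Prod>x\<in>#M. [:- x, 1:]"
  have IH: "norm (coeff ?p i) \<le> (1 + C) ^ size M" for i
    by (rule add.IH) (use add.prems in auto)
  have a: "norm a \<le> C" using add.prems by auto
  have C: "0 \<le> C"
    using a norm_ge_zero order_trans by blast
  have "norm (coeff ([:- a, 1:] * ?p) i) \<le> norm a * norm (coeff ?p i) + (1 + C) ^ size M"
  proof (cases i)
    case 0
    then show ?thesis
      using C by (simp add: norm_mult)
  next
    case (Suc j)
    have "norm (coeff ?p j - a * coeff ?p i) \<le> norm (coeff ?p j) + norm a * norm (coeff ?p i)"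
      by (metis norm_mult norm_triangle_ineq4)
    then show ?thesis
      using IH[of j] Suc by simp
  qed
  also have "norm a * norm (coeff ?p i) \<le> C * (1 + C) ^ size M"
    using a IH C by (intro mult_mono) auto
  finally show ?case
    by (simp add: algebra_simps)
qed

text \<open>A polynomial is recovered from its coefficient list, and only finitely many lists over
  \<open>S\<close> have bounded length.\<close>

lemma finite_polys_bounded:
  assumes "finite S"
  shows "finite {p :: 'a::zero poly. degree p \<le> n \<and> (\<forall>i. coeff p i \<in> S)}"
proof (rule finite_subset)
  show "{p :: 'a poly. degree p \<le> n \<and> (\<forall>i. coeff p i \<in> S)}
      \<subseteq> Poly ` {xs. set xs \<subseteq> S \<and> length xs \<le> Suc n}"
  proof safe
    fix p :: "'a poly"
    assume p: "degree p \<le> n" "\<forall>i. coeff p i \<in> S"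
    have "set (coeffs p) \<subseteq> S"
      using p(2) by (auto simp: coeffs_def)
    moreover have "length (coeffs p) \<le> Suc n"
      using p(1) by (simp add: length_coeffs_degree coeffs_def)
    ultimately show "p \<in> Poly ` {xs. set xs \<subseteq> S \<and> length xs \<le> Suc n}"
      by (intro image_eqI[of _ _ "coeffs p"]) auto
  qed
  show "finite (Poly ` {xs. set xs \<subseteq> S \<and> length xs \<le> Suc n})"
    using assms by (intro finite_imageI finite_lists_length_le)
qed

text \<open>Gauss's lemma makes the coefficients integers, and the root bound \<open>C\<close>
  limits their size. The finite set depends on \<open>C\<close> and \<open>n\<close> alone, so it
  serves a whole family of polynomials \<open>A\<close> at once.\<close>

lemma min_poly_in_finite_set:
  fixes A :: "int poly"
  assumes "lead_coeff A = 1" "poly (int_poly_of A) z = 0"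
    and C: "\<And>w. poly (int_poly_of A) w = 0 \<Longrightarrow> norm (w::complex) \<le> C"
    and deg: "degree (min_poly z) \<le> n"
  shows "min_poly z \<in> {p. degree p \<le> n \<and> (\<forall>i. coeff p i \<in> of_int ` {- \<lceil>(1 + C) ^ n\<rceil>..\<lceil>(1 + C) ^ n\<rceil>})}"
proof -
  have alg: "algebraic z"
    using assms by (intro algebraic_int_imp_algebraic) (auto simp: algebraic_int_altdef_ipoly)
  note m = min_poly_properties[OF alg]
  have dvd: "min_poly z dvd int_poly_of A"
    using m assms(2) by (intro irreducible_dvd_of_common_root[of _ z]) auto
  then obtain p' where p': "min_poly z = int_poly_of p'"
    using monic_factor_int_coeffs m assms(1) by blast
  have "min_poly z \<noteq> 0"
    using m by auto
  obtain k where k: "int_poly_of A = min_poly z * k"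
    using dvd by blast
  have "cpoly (int_poly_of A) = cpoly (min_poly z) * cpoly k"
    by (simp only: k cpoly_mult)
  then have roots: "poly (int_poly_of A) w = 0" if "poly (cpoly (min_poly z)) w = 0" for w
    using that by simp
  have "C \<ge> 0"
    using C[OF assms(2)] norm_ge_zero order_trans by blast
  have "coeff (min_poly z) i \<in> of_int ` {- \<lceil>(1 + C) ^ n\<rceil>..\<lceil>(1 + C) ^ n\<rceil>}" for i
  proof -
    have eq: "cpoly (min_poly z) = (\<Prod>x\<in>#proots (cpoly (min_poly z)). [:- x, 1:])"
      using complex_poly_decompose_multiset[of "cpoly (min_poly z)"] m(1)
      by (simp add: lead_coeff_cpoly del: degree_cpoly)
    have "norm (coeff (cpoly (min_poly z)) i) \<le> (1 + C) ^ size (proots (cpoly (min_poly z)))"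
      by (subst eq, rule norm_coeff_prod_linear_le)
        (use \<open>min_poly z \<noteq> 0\<close> C roots in auto)
    also have "\<dots> \<le> (1 + C) ^ n"
      using deg \<open>C \<ge> 0\<close> by (intro power_increasing) (auto simp: size_proots_complex)
    finally have "\<bar>real_of_int (coeff p' i)\<bar> \<le> (1 + C) ^ n"
      by (simp add: p' coeff_map_poly)
    then have "coeff p' i \<in> {- \<lceil>(1 + C) ^ n\<rceil>..\<lceil>(1 + C) ^ n\<rceil>}"
      by (auto simp: abs_le_iff) linarith+
    then show ?thesis
      by (auto simp: p' coeff_map_poly)
  qed
  then show ?thesis
    using deg by blast
qed

section \<open>Linear deficit suffices\<close>

text \<open>Every minimal polynomial of a root divides \<open>A\<close>, so it inherits simple
  roots; hence degree and trace are the cardinality and the sum of a conjugacy class. The weight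
  \<open>g\<close> is kept arbitrary so that both deficits and degrees can be summed by
  class.\<close>

lemma sum_over_conjugacy_classes:
  fixes A :: "int poly" and g :: "complex \<Rightarrow> real"
  defines "R \<equiv> {z :: complex. poly (int_poly_of A) z = 0}"
  assumes "lead_coeff A = 1" "card R = degree A"
  shows "(\<Sum>z\<in>R. g z) = (\<Sum>p\<in>min_poly ` R. \<Sum>z | poly (cpoly p) z = 0. g z)"
    and "z \<in> R \<Longrightarrow> algebraic_int z"
    and "z \<in> R \<Longrightarrow> conjugates z \<subseteq> R"
    and "z \<in> R \<Longrightarrow> card (conjugates z) = alg_degree z"
    and "z \<in> R \<Longrightarrow> alg_trace z = \<Sum>(conjugates z)"
proof -
  have "A \<noteq> 0"
    using assms(2) by auto
  then have nz: "int_poly_of A \<noteq> (0 :: complex poly)"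
    by simp
  show int: "algebraic_int z" if "z \<in> R" for z
    using that assms(2) by (auto simp: R_def algebraic_int_altdef_ipoly)
  then have alg: "algebraic z" if "z \<in> R" for z
    using that by auto
  have dvd: "cpoly (min_poly z) dvd int_poly_of A" if "z \<in> R" for z
  proof -
    have "min_poly z dvd int_poly_of A"
      using min_poly_properties[OF alg[OF that]] that
      by (intro irreducible_dvd_of_common_root[of _ z]) (auto simp: R_def)
    then obtain k where "int_poly_of A = min_poly z * k"
      by blast
    then have "cpoly (int_poly_of A) = cpoly (min_poly z) * cpoly k"
      by (simp only: cpoly_mult)
    then show ?thesis
      by simp
  qed
  show sub: "conjugates z \<subseteq> R" if "z \<in> R" for z
    using dvd[OF that] by (auto simp: R_def conjugates_def elim!: dvdE)
  have card: "card {w. poly (cpoly (min_poly z)) w = 0} = degree (cpoly (min_poly z))" if "z \<in> R" for z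
    by (rule card_roots_factor[OF dvd[OF that] nz]) (use assms(3) in \<open>simp add: R_def\<close>)
  then show "card (conjugates z) = alg_degree z" if "z \<in> R"
    using that by (simp add: conjugates_def alg_degree_def)
  have nz': "cpoly (min_poly z) \<noteq> 0" if "z \<in> R" for z
    using dvd[OF that] nz by auto
  show "alg_trace z = \<Sum>(conjugates z)" if "z \<in> R"
    using proots_eq_mset_set[OF nz'[OF that] card[OF that]]
    by (simp add: alg_trace_def conjugates_def sum_unfold_sum_mset)
  have "{x\<in>R. min_poly x = p} = {z. poly (cpoly p) z = 0}" if "p \<in> min_poly ` R" for p
  proof -
    from that obtain z where z: "z \<in> R" "p = min_poly z"
      by blast
    then show ?thesis
      using sub[OF z(1)] min_poly_eq_iff_conjugate[OF alg alg] by (auto simp: conjugates_def)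
  qed
  moreover have "finite R"
    unfolding R_def using nz by (rule poly_roots_finite)
  ultimately show "(\<Sum>z\<in>R. g z) = (\<Sum>p\<in>min_poly ` R. \<Sum>z | poly (cpoly p) z = 0. g z)"
    by (simp add: sum.image_gen[of R g min_poly])
qed

lemma loglog_quotient_le_linear:
  fixes \<epsilon> :: real
  assumes "\<epsilon> > 0"
  shows "\<forall>\<^sub>F n in sequentially. 1 / 4 * (ln (ln (real n)) / ln (ln (ln (real n)))) \<le> \<epsilon> * real n"
  using assms by real_asymp

text \<open>Among the conjugacy classes of roots of one \<open>A m\<close>, those of degree less than a fixed bound
  belong to a finite set of minimal polynomials independent of \<open>m\<close>, so they contribute a bounded
  amount to the sum of \<open>2 - z\<close>. For large \<open>m\<close> some class of large degree must then have
  at least the average deficit up to a constant factor.\<close>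

lemma infinite_small_trace_of_linear_deficit:
  fixes A :: "nat \<Rightarrow> int poly" and C \<epsilon> :: real
  assumes monic: "\<And>m. lead_coeff (A m) = 1"
    and simple: "\<And>m. card {z :: complex. poly (int_poly_of (A m)) z = 0} = degree (A m)"
    and roots: "\<And>m z. poly (int_poly_of (A m)) z = 0 \<Longrightarrow> z \<in> \<real> \<and> 0 < Re z \<and> Re z \<le> C"
    and deficit: "\<And>m. (\<Sum>z | poly (int_poly_of (A m)) z = 0. 2 - Re z) \<ge> \<epsilon> * degree (A m)"
    and "\<epsilon> > 0" and unbounded: "filterlim (\<lambda>m. degree (A m)) at_top sequentially"
  shows "infinite {n :: nat. n > 0 \<and>
           (\<exists>\<alpha> :: complex. totally_positive \<alpha> \<and> alg_degree \<alpha> = n \<and>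
              Re (alg_trace \<alpha>) < 2 * real n - 1 / 4 * (ln (ln (real n)) / ln (ln (ln (real n)))))}"
    (is "infinite ?S")
proof
  assume fin: "finite ?S"
  obtain N1 where N1: "\<And>n. n \<in> ?S \<Longrightarrow> n < N1"
    using fin by (metis (no_types, lifting) finite_nat_set_iff_bounded)
  obtain N2 where N2: "\<And>n. n \<ge> N2 \<Longrightarrow>
      1 / 4 * (ln (ln (real n)) / ln (ln (ln (real n)))) \<le> \<epsilon> / 2 * real n"
    using loglog_quotient_le_linear[of "\<epsilon> / 2"] \<open>\<epsilon> > 0\<close>
    unfolding eventually_sequentially by auto
  \<comment> \<open>From degree \<open>N\<close> on, \<open>?S\<close> has no members and the
    iterated logarithm term is at most half the assumed deficit rate.\<close>
  define N where "N = max 1 (max N1 N2)"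
  define F where "F = {p :: rat poly. degree p \<le> N \<and>
    (\<forall>i. coeff p i \<in> of_int ` {- \<lceil>(1 + C) ^ N\<rceil>..\<lceil>(1 + C) ^ N\<rceil>})}"
  have "finite F"
    unfolding F_def by (rule finite_polys_bounded) simp
  \<comment> \<open>Positivity of the roots gives a class of degree below \<open>N\<close> a deficit
    of at most \<open>2 * N\<close>, and at most \<open>card F\<close> such classes occur.\<close>
  define K where "K = real (card F) * (2 * N)"

  have bound: "\<epsilon> * degree (A m) \<le> \<epsilon> / 2 * degree (A m) + K" for m
  proof -
    define R where "R = {z :: complex. poly (int_poly_of (A m)) z = 0}"
    note cl = sum_over_conjugacy_classes[OF monic[of m] simple[of m], folded R_def]
    have "A m \<noteq> 0"
      using monic[of m] by auto
    then have "finite R"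
      unfolding R_def by (intro poly_roots_finite) simp
    have posR: "z \<in> \<real> \<and> 0 < Re z \<and> Re z \<le> C" if "z \<in> R" for z
      using roots that by (auto simp: R_def)
    have normR: "norm z \<le> C" if "z \<in> R" for z
      using posR[OF that] by (simp add: in_Reals_norm)
    have class_bound: "(\<Sum>z | poly (cpoly p) z = 0. 2 - Re z)
        \<le> \<epsilon> / 2 * (\<Sum>z | poly (cpoly p) z = 0. 1) + (if p \<in> F then 2 * N else 0)"
      if "p \<in> min_poly ` R" for p
    proof -
      from that obtain z where z: "z \<in> R" "p = min_poly z"
        by blast
      let ?n = "alg_degree z"
      have conj: "{w. poly (cpoly p) w = 0} = conjugates z"
        by (simp add: z conjugates_def)
      have "z \<in> conjugates z"
        using min_poly_properties(3)[of z] cl(2)[OF z(1)] by (auto simp: conjugates_def)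
      have fin: "finite (conjugates z)"
        using cl(3)[OF z(1)] \<open>finite R\<close> finite_subset by blast
      then have "?n > 0"
        using cl(4)[OF z(1)] \<open>z \<in> conjugates z\<close> by (metis card_gt_0_iff empty_iff)
      have eq: "(\<Sum>w\<in>conjugates z. 2 - Re w) = 2 * real ?n - Re (alg_trace z)"
        using cl(4,5)[OF z(1)] by (simp add: sum_subtractf)
      have tr: "Re (alg_trace z) \<ge> 0"
        unfolding cl(5)[OF z(1)] Re_sum
      proof (rule sum_nonneg)
        show "0 \<le> Re w" if "w \<in> conjugates z" for w
          using posR[of w] cl(3)[OF z(1)] that by fastforce
      qed
      have tp: "totally_positive z"
        using cl(2,3)[OF z(1)] posR by (auto simp: totally_positive_def)
      show ?thesis
      proof (cases "?n < N")
        case True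
        then have "p \<in> F"
          unfolding F_def z(2) using z(1) normR True
          by (intro min_poly_in_finite_set[OF monic[of m]]) (auto simp: R_def alg_degree_def)
        then have "(if p \<in> F then 2 * N else 0) = 2 * N"
          by simp
        moreover have "2 * real ?n - Re (alg_trace z) \<le> 2 * N"
          using tr True by linarith
        moreover have "0 \<le> \<epsilon> / 2 * (\<Sum>w\<in>conjugates z. 1)"
          using \<open>\<epsilon> > 0\<close> by simp
        ultimately show ?thesis
          unfolding conj eq by linarith
      next
        case False
        then have "\<not> ?n < N1"
          by (simp add: N_def)
        then have "?n \<notin> ?S"
          using N1 by blast
        \<comment> \<open>Since \<open>z\<close> is totally positive of positive degree, absence
          from \<open>?S\<close> can only mean that the trace bound fails.\<close>
        then have "\<not> Re (alg_trace z) < 2 * real ?n - 1 / 4 * (ln (ln (real ?n)) / ln (ln (ln (real ?n))))"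
          using tp \<open>?n > 0\<close> by blast
        moreover have "1 / 4 * (ln (ln (real ?n)) / ln (ln (ln (real ?n)))) \<le> \<epsilon> / 2 * real ?n"
          using False by (intro N2) (auto simp: N_def)
        ultimately have "2 * real ?n - Re (alg_trace z) \<le> \<epsilon> / 2 * real ?n"
          by linarith
        then show ?thesis
          unfolding conj eq by (simp add: cl(4)[OF z(1)])
      qed
    qed
    have "\<epsilon> * degree (A m) \<le> (\<Sum>z\<in>R. 2 - Re z)"
      using deficit[of m] by (simp add: R_def)
    also have "\<dots> = (\<Sum>p\<in>min_poly ` R. \<Sum>z | poly (cpoly p) z = 0. 2 - Re z)"
      by (rule cl(1))
    also have "\<dots> \<le> (\<Sum>p\<in>min_poly ` R. \<epsilon> / 2 * (\<Sum>z | poly (cpoly p) z = 0. 1) + (if p \<in> F then 2 * N else 0))"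
      by (intro sum_mono class_bound)
    also have "\<dots> = \<epsilon> / 2 * (\<Sum>p\<in>min_poly ` R. \<Sum>z | poly (cpoly p) z = 0. 1)
        + (\<Sum>p\<in>min_poly ` R. if p \<in> F then 2 * N else 0)"
      by (simp add: sum.distrib sum_distrib_left)
    also have "(\<Sum>p\<in>min_poly ` R. \<Sum>z | poly (cpoly p) z = 0. 1) = (\<Sum>z\<in>R. 1 :: real)"
      by (rule cl(1)[symmetric])
    also have "\<dots> = degree (A m)"
      using simple[of m] by (simp add: R_def)
    also have "(\<Sum>p\<in>min_poly ` R. if p \<in> F then 2 * N else 0) = (\<Sum>p\<in>min_poly ` R \<inter> F. 2 * N)"
      using \<open>finite R\<close> by (intro sum.inter_restrict[symmetric]) simp
    also have "real \<dots> \<le> K"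
      using card_mono[OF \<open>finite F\<close>, of "min_poly ` R \<inter> F"] by (simp add: K_def mult_right_mono)
    finally show ?thesis
      by simp
  qed
  \<comment> \<open>\<open>K\<close> does not depend on \<open>m\<close>, so a degree beyond
    \<open>2 * K / \<epsilon>\<close> contradicts \<open>bound\<close>.\<close>
  have "eventually (\<lambda>m. Suc (nat \<lceil>2 * K / \<epsilon>\<rceil>) \<le> degree (A m)) sequentially"
    using unbounded by (simp only: filterlim_at_top)
  then obtain m where "Suc (nat \<lceil>2 * K / \<epsilon>\<rceil>) \<le> degree (A m)"
    by (auto dest: eventually_happens)
  then have "2 * K / \<epsilon> < degree (A m)"
    by linarith
  then have "2 * K < \<epsilon> * degree (A m)"
    using \<open>\<epsilon> > 0\<close> by (simp add: pos_divide_less_eq mult.commute)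
  moreover have "\<epsilon> * degree (A m) \<le> 2 * K"
    using bound[of m] by linarith
  ultimately show False
    by linarith
qed

section \<open>Homogenised Chebyshev polynomials\<close>

text \<open>This is \<open>q ^ n * T_n (p / q)\<close> for the monic Chebyshev normalisation, that
  is, the Dickson polynomial with parameter \<open>q ^ 2\<close>. Without division it also makes
  sense for integer polynomials \<open>p\<close> and \<open>q\<close>.\<close>

fun chebyshev_hom :: "'a::comm_ring_1 \<Rightarrow> 'a \<Rightarrow> nat \<Rightarrow> 'a" where
  "chebyshev_hom p q 0 = 2"
| "chebyshev_hom p q (Suc 0) = p"
| "chebyshev_hom p q (Suc (Suc n)) = p * chebyshev_hom p q (Suc n) - q ^ 2 * chebyshev_hom p q n"

lemma chebyshev_hom_cos: "chebyshev_hom (2 * q * cos t) q n = 2 * q ^ n * cos (real n * t)"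
proof (induction n rule: induct_nat_012)
  case (ge2 n)
  have "cos (real (Suc (Suc n)) * t) = 2 * cos t * cos (real (Suc n) * t) - cos (real n * t)"
    using cos_add[of "real (Suc n) * t" t] cos_diff[of "real (Suc n) * t" t]
    by (simp add: algebra_simps)
  moreover have "chebyshev_hom (2 * q * cos t) q (Suc (Suc n))
      = 2 * q ^ Suc (Suc n) * (2 * cos t * cos (real (Suc n) * t) - cos (real n * t))"
    by (simp only: chebyshev_hom.simps ge2)
      (simp add: algebra_simps power2_eq_square del: of_nat_Suc)
  ultimately show ?case
    by (simp only:)
qed auto

lemma poly_chebyshev_hom:
  fixes P Q :: "int poly" and x :: "'a::field_char_0"
  shows "poly (int_poly_of (chebyshev_hom P Q n)) x
    = chebyshev_hom (poly (int_poly_of P) x) (poly (int_poly_of Q) x) n"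
proof (induction n rule: induct_nat_012)
  case 0
  have "poly (int_poly_of (smult 2 1)) x = 2"
    unfolding int_poly_of_smult by simp
  then show ?case
    by (simp add: numeral_poly)
next
  case (ge2 n)
  then show ?case
    by (simp add: int_poly_of_diff int_poly_of_mult power2_eq_square)
qed auto

section \<open>Degree and top two coefficients\<close>

lemma degree_chebyshev_hom_le:
  fixes P Q :: "'a::comm_ring_1 poly"
  assumes "degree P \<le> d" "degree Q \<le> d"
  shows "degree (chebyshev_hom P Q n) \<le> n * d"
proof (induction n rule: induct_nat_012)
  case (ge2 n)
  have "degree (P * chebyshev_hom P Q (Suc n)) \<le> d + Suc n * d"
    using degree_mult_le assms(1) ge2(2) by (meson add_mono le_trans)
  moreover have "degree (Q ^ 2 * chebyshev_hom P Q n) \<le> (d + d) + n * d"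
    using degree_mult_le assms(2) ge2(1) unfolding power2_eq_square by (meson add_mono le_trans)
  ultimately show ?case
    by (auto intro!: degree_diff_le simp: algebra_simps)
qed (use assms in auto)

lemma coeff_mult_pred_degree:
  fixes p q :: "'a::comm_ring_1 poly"
  assumes "degree p \<le> a" "degree q \<le> b" "a > 0" "b > 0"
  shows "coeff (p * q) (a + b - 1) = coeff p a * coeff q (b - 1) + coeff p (a - 1) * coeff q b"
proof -
  have "coeff (p * q) (a + b - 1) = (\<Sum>i\<in>{a - 1, a}. coeff p i * coeff q (a + b - 1 - i))"
    unfolding coeff_mult
  proof (rule sum.mono_neutral_right)
    show "\<forall>i\<in>{..a + b - 1} - {a - 1, a}. coeff p i * coeff q (a + b - 1 - i) = 0"
    proof
      fix i assume "i \<in> {..a + b - 1} - {a - 1, a}"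
      then have "a < i \<or> b < a + b - 1 - i"
        using assms(3,4) by auto
      then show "coeff p i * coeff q (a + b - 1 - i) = 0"
        using assms(1,2) by (auto simp: coeff_eq_0)
    qed
  qed (use assms in auto)
  then show ?thesis
    using assms(3,4) by (simp add: algebra_simps)
qed

lemma coeff_mult_top:
  fixes p q :: "'a::comm_ring_1 poly"
  assumes "degree p \<le> a" "degree q \<le> b"
  shows "coeff (p * q) (a + b) = coeff p a * coeff q b"
proof -
  have "coeff (p * q) (a + b) = (\<Sum>i\<in>{a}. coeff p i * coeff q (a + b - i))"
    unfolding coeff_mult
  proof (rule sum.mono_neutral_right)
    show "\<forall>i\<in>{..a + b} - {a}. coeff p i * coeff q (a + b - i) = 0"
    proof
      fix i assume "i \<in> {..a + b} - {a}"
      then have "a < i \<or> b < a + b - i"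
        by auto
      then show "coeff p i * coeff q (a + b - i) = 0"
        using assms by (auto simp: coeff_eq_0)
    qed
  qed auto
  then show ?thesis
    by simp
qed

text \<open>Because \<open>Q\<close> has smaller degree than \<open>P\<close>, the top two
  coefficients behave as for the power of \<open>P\<close>; the trace is multiplied by the
  index.\<close>

lemma top_coeffs_chebyshev_hom:
  fixes P Q :: "'a::comm_ring_1 poly"
  assumes "degree P = d" "lead_coeff P = 1" "degree Q < d"
  shows "coeff (chebyshev_hom P Q (Suc n)) (Suc n * d) = 1 \<and>
    coeff (chebyshev_hom P Q (Suc n)) (Suc n * d - 1) = of_nat (Suc n) * coeff P (d - 1)"
proof (induction n)
  case 0
  show ?case
    using assms by auto
next
  case (Suc n)
  let ?A = "chebyshev_hom P Q"
  have "d > 0"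
    using assms(3) by simp
  have deg: "degree (?A k) \<le> k * d" for k
    using assms by (intro degree_chebyshev_hom_le) auto
  have "degree (Q ^ 2 * ?A n) \<le> (degree Q + degree Q) + n * d"
    using degree_mult_le deg[of n] unfolding power2_eq_square by (meson add_mono le_trans le_refl)
  \<comment> \<open>The degree is at most \<open>(n + 2) * d - 2\<close>, below both positions of
    interest.\<close>
  also have "\<dots> < d + Suc n * d - 1"
    using assms(3) by simp
  finally have low: "coeff (Q ^ 2 * ?A n) (d + Suc n * d) = 0"
      "coeff (Q ^ 2 * ?A n) (d + Suc n * d - 1) = 0"
    by (simp_all add: coeff_eq_0)
  have "coeff (P * ?A (Suc n)) (d + Suc n * d) = 1"
    using coeff_mult_top[of P d "?A (Suc n)" "Suc n * d"] deg[of "Suc n"] assms(1,2) Suc by simp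
  moreover have "coeff (P * ?A (Suc n)) (d + Suc n * d - 1) = of_nat (Suc (Suc n)) * coeff P (d - 1)"
    using coeff_mult_pred_degree[of P d "?A (Suc n)" "Suc n * d"] deg[of "Suc n"] assms(1,2) Suc \<open>d > 0\<close>
    by (simp add: algebra_simps)
  ultimately show ?case
    using low by (simp add: algebra_simps)
qed

text \<open>Vieta's formula for the sum of the roots. For the empty multiset, truncated subtraction
  would point at the leading coefficient 1.\<close>

lemma coeff_prod_linear_pred:
  fixes M :: "'a::comm_ring_1 multiset"
  assumes "M \<noteq> {#}"
  shows "coeff (\<Prod>x\<in>#M. [:- x, 1:]) (size M - 1) = - sum_mset M"
  using assms
proof (induction M)
  case (add a M)
  let ?p = "\<Prod>x\<in>#M. [:- x, 1:]"
  \<comment> \<open>A new factor subtracts \<open>a\<close> times the old top coefficient from the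
    old second one, so the former has to be known to be 1.\<close>
  have top: "coeff (\<Prod>x\<in>#M. [:- x, 1:]) (size M) = 1 \<and> degree (\<Prod>x\<in>#M. [:- x, 1:]) \<le> size M"
    for M :: "'a multiset"
  proof (induction M)
    case (add a M)
    let ?p = "\<Prod>x\<in>#M. [:- x, 1:]"
    have "degree ([:- a, 1:] * ?p) \<le> 1 + size M"
      using degree_mult_le[of "[:- a, 1:]" ?p] add by (simp add: degree_pCons_eq_if split: if_splits)
    moreover have "coeff ?p (Suc (size M)) = 0"
      using add by (simp add: coeff_eq_0)
    ultimately show ?case
      using add by simp
  qed simp
  show ?case
  proof (cases "M = {#}")
    case False
    then obtain k where k: "size M = Suc k"
      by (cases "size M") auto
    then show ?thesis
      using add.IH[OF False] top[of M] by simp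
  qed simp
qed simp

lemma sum_simple_roots:
  fixes p :: "complex poly"
  assumes "lead_coeff p = 1" "degree p > 0" "card {z. poly p z = 0} = degree p"
  shows "(\<Sum>z | poly p z = 0. z) = - coeff p (degree p - 1)"
proof -
  have "p \<noteq> 0"
    using assms(1) by auto
  have "p = (\<Prod>x\<in>#proots p. [:- x, 1:])"
    using complex_poly_decompose_multiset[of p] assms(1) by simp
  then have "coeff p (degree p - 1) = - sum_mset (proots p)"
    using coeff_prod_linear_pred[of "proots p"] assms(2)
    by (metis size_proots_complex size_empty less_irrefl)
  then show ?thesis
    by (simp add: proots_eq_mset_set[OF \<open>p \<noteq> 0\<close> assms(3)] sum_unfold_sum_mset)
qed

section \<open>Real simple roots from sign alternation\<close>

lemma poly_int_poly_of_real:
  "poly (int_poly_of p) (of_real x :: complex) = of_real (poly (int_poly_of p) x)"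
  by (induction p) (simp_all add: map_poly_pCons)

text \<open>For each of the \<open>n\<close> zeros \<open>2 * cos (t k)\<close> of the Chebyshev
  polynomial, \<open>P - 2 * cos (t k) * Q\<close> alternates in sign at \<open>d + 1\<close> points
  and so has a root in each of the \<open>d\<close> gaps. These \<open>n * d\<close> roots are
  distinct and exhaust the degree.\<close>

lemma chebyshev_hom_roots:
  fixes P Q :: "int poly" and y :: "nat \<Rightarrow> real"
  assumes P: "degree P = d" "lead_coeff P = 1" and Q: "degree Q < d"
    and y: "\<And>i j. i < j \<Longrightarrow> j \<le> d \<Longrightarrow> y i < y j"
    and Q_pos: "\<And>x. y 0 \<le> x \<Longrightarrow> poly (int_poly_of Q) x > 0"
    and alternating: "\<And>i. i \<le> d \<Longrightarrow>
      2 * poly (int_poly_of Q) (y i) \<le> (-1) ^ i * poly (int_poly_of P) (y i)"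
    and "n > 0"
  defines "R \<equiv> {z :: complex. poly (int_poly_of (chebyshev_hom P Q n)) z = 0}"
  shows "card R = n * d" "z \<in> R \<Longrightarrow> z \<in> \<real> \<and> y 0 < Re z \<and> Re z < y d"
proof -
  let ?P = "poly (int_poly_of P) :: real \<Rightarrow> real" and ?Q = "poly (int_poly_of Q) :: real \<Rightarrow> real"
  \<comment> \<open>The zeros of \<open>cos (n * t)\<close> between 0 and \<open>pi\<close>.\<close>
  define t where "t k = (2 * real k + 1) * pi / (2 * n)" for k
  have t: "0 < t k" "t k < pi" if "k < n" for k
  proof -
    have "(2 * real k + 1) * pi < 2 * n * pi"
      using that by (intro mult_strict_right_mono) auto
    then show "t k < pi"
      using \<open>n > 0\<close> by (simp add: t_def field_simps)
    show "0 < t k"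
      using \<open>n > 0\<close> by (auto simp: t_def intro!: divide_pos_pos mult_pos_pos)
  qed
  have "\<exists>x. y i < x \<and> x < y (Suc i) \<and> ?P x = 2 * ?Q x * cos (t k)" if "i < d" "k < n" for i k
  proof -
    define p where "p = int_poly_of P - smult (2 * cos (t k)) (int_poly_of Q)"
    have "\<bar>cos (t k)\<bar> < 1"
      using cos_monotone_0_pi[of 0 "t k"] cos_monotone_0_pi[of "t k" pi] t[OF that(2)] by auto
    \<comment> \<open>The subtracted term is smaller in absolute value than \<open>2 * Q\<close>, so
      it cannot change the sign of \<open>P\<close> at a node.\<close>
    have pos: "0 < (-1) ^ j * poly p (y j)" if "j \<le> d" for j
    proof -
      have "?Q (y j) > 0"
        using y[of 0 j] that by (intro Q_pos) (cases j; fastforce)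
      have "(-1) ^ j * cos (t k) < 1"
        using \<open>\<bar>cos (t k)\<bar> < 1\<close> by (cases "even j") auto
      then have "2 * ?Q (y j) * ((-1) ^ j * cos (t k)) < 2 * ?Q (y j) * 1"
        using \<open>?Q (y j) > 0\<close> by (intro mult_strict_left_mono) auto
      with alternating[OF that] show ?thesis
        by (simp add: p_def algebra_simps)
    qed
    have "0 < ((-1) ^ i * poly p (y i)) * ((-1) ^ Suc i * poly p (y (Suc i)))"
      using that by (intro mult_pos_pos pos) auto
    also have "\<dots> = - (poly p (y i) * poly p (y (Suc i)))"
      by (cases "even i") auto
    finally have "poly p (y i) * poly p (y (Suc i)) < 0"
      by simp
    then obtain x where "y i < x" "x < y (Suc i)" "poly p x = 0"
      using poly_IVT[of "y i" "y (Suc i)" p] y[of i "Suc i"] \<open>i < d\<close> by auto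
    then show ?thesis
      by (auto simp: p_def)
  qed
  then obtain x where x: "\<And>i k. i < d \<Longrightarrow> k < n \<Longrightarrow>
      y i < x i k \<and> x i k < y (Suc i) \<and> ?P (x i k) = 2 * ?Q (x i k) * cos (t k)"
    by metis
  have mono: "y i \<le> y j" if "i \<le> j" "j \<le> d" for i j
    using y[of i j] that by (cases "i = j") auto
  let ?f = "\<lambda>(i, k). complex_of_real (x i k)" and ?D = "{..<d} \<times> {..<n}"
  have bounds: "y 0 < x i k \<and> x i k < y d" if "i < d" "k < n" for i k
    using x[OF that] mono[of 0 i] mono[of "Suc i" d] that by auto
  \<comment> \<open>Disjoint gaps determine \<open>i\<close>; at a given point the quotient
    \<open>P / (2 * Q)\<close> equals \<open>cos (t k)\<close> and determines
    \<open>k\<close>.\<close>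
  have inj: "inj_on ?f ?D"
  proof -
    have "i = j \<and> k = l" if D: "i < d" "k < n" "j < d" "l < n" and eq: "x i k = x j l" for i j k l
    proof -
      have "i = j"
      proof (rule ccontr)
        assume "i \<noteq> j"
        then consider "Suc i \<le> j" | "Suc j \<le> i"
          by linarith
        then show False
          by cases (use x[OF D(1,2)] x[OF D(3,4)] mono[of "Suc i" j] mono[of "Suc j" i] D eq in auto)
      qed
      have "?Q (x i k) > 0"
        using bounds[OF D(1,2)] by (intro Q_pos) auto
      then have "cos (t k) = cos (t l)"
        using x[OF D(1,2)] x[OF D(3,4)] eq by simp
      then have "t k = t l"
        by (rule cos_inj_pi[rotated -1]) (use t[OF D(2)] t[OF D(4)] in \<open>simp_all only: less_imp_le\<close>)
      then have "(2 * real k + 1) * pi = (2 * real l + 1) * pi"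
        using \<open>n > 0\<close> by (simp add: t_def)
      then have "real k = real l"
        by simp
      then show ?thesis
        using \<open>i = j\<close> by simp
    qed
    then show ?thesis
      by (auto simp: inj_on_def)
  qed
  have sub: "?f ` ?D \<subseteq> R"
  proof safe
    fix i k assume D: "i < d" "k < n"
    have "real n * t k = (2 * real k + 1) * (pi / 2)"
      using \<open>n > 0\<close> by (simp add: t_def)
    then have "cos (real n * t k) = 0"
      unfolding cos_zero_iff_int by (intro exI[of _ "2 * int k + 1"]) auto
    then have "poly (int_poly_of (chebyshev_hom P Q n)) (x i k) = 0"
      using x[OF D] chebyshev_hom_cos[of "?Q (x i k)" "t k" n] by (simp add: poly_chebyshev_hom)
    then show "complex_of_real (x i k) \<in> R"
      by (simp add: R_def poly_int_poly_of_real)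
  qed
  obtain n' where n': "n = Suc n'"
    using \<open>n > 0\<close> by (cases n) auto
  have top: "coeff (chebyshev_hom P Q n) (n * d) = 1"
    using top_coeffs_chebyshev_hom[OF P Q, of n'] by (simp add: n')
  then have "chebyshev_hom P Q n \<noteq> 0"
    by auto
  then have nz: "int_poly_of (chebyshev_hom P Q n) \<noteq> (0 :: complex poly)"
    by simp
  \<comment> \<open>The degree bound shows that the roots already found are all complex
    roots.\<close>
  have "card R \<le> degree (chebyshev_hom P Q n)"
    using card_poly_roots_bound[OF nz] by (simp add: R_def)
  also have "\<dots> \<le> n * d"
    using P Q by (intro degree_chebyshev_hom_le) auto
  finally have "card R \<le> n * d" .
  moreover have "card (?f ` ?D) = n * d"
    by (simp add: card_image[OF inj] card_cartesian_product)
  moreover have "finite R"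
    unfolding R_def using nz by (rule poly_roots_finite)
  ultimately have "?f ` ?D = R"
    using sub by (metis card_mono card_subset_eq le_antisym)
  then show "card R = n * d" "z \<in> R \<Longrightarrow> z \<in> \<real> \<and> y 0 < Re z \<and> Re z < y d"
    using \<open>card (?f ` ?D) = n * d\<close> bounds by auto
qed

text \<open>Degree and trace of \<open>chebyshev_hom P Q n\<close> are \<open>n\<close> times those
  of \<open>P\<close>, so a positive deficit of \<open>P\<close> alone yields a deficit linear in
  the degree.\<close>

lemma infinite_small_trace_of_alternating:
  fixes P Q :: "int poly" and y :: "nat \<Rightarrow> real"
  assumes P: "degree P = d" "lead_coeff P = 1" and Q: "degree Q < d"
    and y: "\<And>i j. i < j \<Longrightarrow> j \<le> d \<Longrightarrow> y i < y j" and "0 < y 0"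
    and Q_pos: "\<And>x. y 0 \<le> x \<Longrightarrow> poly (int_poly_of Q) x > 0"
    and alternating: "\<And>i. i \<le> d \<Longrightarrow>
      2 * poly (int_poly_of Q) (y i) \<le> (-1) ^ i * poly (int_poly_of P) (y i)"
    and trace: "- coeff P (d - 1) < 2 * int d"
  shows "infinite {n :: nat. n > 0 \<and>
           (\<exists>\<alpha> :: complex. totally_positive \<alpha> \<and> alg_degree \<alpha> = n \<and>
              Re (alg_trace \<alpha>) < 2 * real n - 1 / 4 * (ln (ln (real n)) / ln (ln (ln (real n)))))}"
proof (rule infinite_small_trace_of_linear_deficit)
  \<comment> \<open>The shift avoids index 0, where the value is the non-monic constant 2.\<close>
  define A where "A m = chebyshev_hom P Q (Suc m)" for m
  have "d > 0"
    using Q by simp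
  note top = top_coeffs_chebyshev_hom[OF P Q]
  have degree: "degree (A m) = Suc m * d" for m
  proof (rule antisym)
    show "degree (A m) \<le> Suc m * d"
      unfolding A_def using P Q by (intro degree_chebyshev_hom_le) auto
    show "Suc m * d \<le> degree (A m)"
      using top[of m] by (intro le_degree) (simp add: A_def)
  qed
  show monic: "lead_coeff (A m) = 1" for m
    unfolding degree using top[of m] by (simp add: A_def)
  note roots = chebyshev_hom_roots[OF P Q y Q_pos alternating, of "Suc m" for m, folded A_def]
  show simple: "card {z :: complex. poly (int_poly_of (A m)) z = 0} = degree (A m)" for m
    using roots(1)[of m] by (simp add: degree)
  show "z \<in> \<real> \<and> 0 < Re z \<and> Re z \<le> y d" if "poly (int_poly_of (A m)) z = 0" for m z
    using roots(2)[of m z] that \<open>0 < y 0\<close> by auto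
  show "1 / real d > 0"
    using \<open>d > 0\<close> by simp
  show "filterlim (\<lambda>m. degree (A m)) at_top sequentially"
  proof (rule filterlim_at_top_mono[OF filterlim_ident])
    show "\<forall>\<^sub>F m in sequentially. m \<le> degree (A m)"
      using \<open>d > 0\<close> by (intro always_eventually allI) (cases d; simp add: degree)
  qed
  show "1 / real d * degree (A m) \<le> (\<Sum>z | poly (int_poly_of (A m)) z = 0. 2 - Re z)" for m
  proof -
    have "(\<Sum>z :: complex | poly (int_poly_of (A m)) z = 0. z) = - of_int (coeff (A m) (degree (A m) - 1))"
      using sum_simple_roots[of "int_poly_of (A m)"] monic[of m] simple[of m] \<open>d > 0\<close>
      by (simp add: degree coeff_map_poly)
    also have "\<dots> = of_int (int (Suc m) * (- coeff P (d - 1)))"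
      unfolding degree using top[of m] by (simp add: A_def)
    finally have "Re (\<Sum>z :: complex | poly (int_poly_of (A m)) z = 0. z) = of_int (int (Suc m) * (- coeff P (d - 1)))"
      by (metis Re_complex_of_real of_real_of_int_eq)
    \<comment> \<open>By integrality the deficit of \<open>P\<close> is at least 1; over degree
      \<open>d\<close> this gives the rate \<open>1 / real d\<close>.\<close>
    also have "int (Suc m) * (- coeff P (d - 1)) \<le> int (Suc m) * (2 * int d - 1)"
      using trace by (intro mult_left_mono) auto
    finally have "(\<Sum>z | poly (int_poly_of (A m)) z = 0. Re z) \<le> real (Suc m) * (2 * real d - 1)"
      by simp
    then have "real (Suc m) \<le> (\<Sum>z | poly (int_poly_of (A m)) z = 0. 2 - Re z)"
      using simple[of m] by (simp add: sum_subtractf degree algebra_simps)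
    then show ?thesis
      using \<open>d > 0\<close> by (simp add: degree)
  qed
qed

section \<open>An explicit alternating quotient of degree 40\<close>

text \<open>The polynomial was found by lattice reduction: it approximates \<open>x ^ 8\<close> times the rational
  function with poles at \<open>0\<close> and \<open>\<infinity>\<close> of orders 8 and 32 that equioscillates on
  \<open>[0.072, 4.578]\<close>, with leading coefficient 1 and trace 79.\<close>

definition base_coeffs :: "int list" where
  "base_coeffs = [
    1, -113, 5884, -187678, 4113411, -65903271, 802085425, -7611977540, 57410766936,
    -349175666186, 1732758695798, -7084681835500, 24067901063990, -68437428357361,
    163959121343965, -332900653481519, 575858127804397, -852657620633133, 1085151224245021,
    -1191314451172427, 1131655933702917, -932504644249694, 667873161543946, -416346156483633,
    226092244265100, -106970791064776, 44072976900669, -15792647363695, 4911159087913,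
    -1321270623144, 306185540430, -60760376268, 10245438535, -1452966123, 170936672, -16373534,
    1243718, -72041, 2988, -79, 1]"

definition base_poly :: "int poly" where
  "base_poly = Poly base_coeffs"

text \<open>A pair \<open>(a, b)\<close> stands for the node \<open>a / b\<close>.\<close>

definition nodes :: "(int \<times> int) list" where
  "nodes = [
    (1, 14), (3, 41), (1, 13), (1, 12), (1, 11), (1, 9), (1, 8), (1, 6), (1, 5), (1, 4), (2, 7),
    (3, 8), (3, 7), (4, 7), (2, 3), (3, 4), (1, 1), (8, 7), (5, 4), (7, 5), (5, 3), (9, 5),
    (2, 1), (9, 4), (5, 2), (8, 3), (23, 8), (28, 9), (10, 3), (7, 2), (11, 3), (15, 4), (4, 1),
    (33, 8), (21, 5), (13, 3), (22, 5), (9, 2), (50, 11), (32, 7), (14, 3)]"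

definition node :: "nat \<Rightarrow> real" where
  "node i = of_int (fst (nodes ! i)) / of_int (snd (nodes ! i))"

text \<open>Horner's scheme at \<open>a / b\<close>, returning an unreduced numerator and
  denominator so that evaluation uses integer arithmetic only.\<close>

primrec horner :: "int \<Rightarrow> int \<Rightarrow> int list \<Rightarrow> int \<times> int" where
  "horner a b [] = (0, 1)"
| "horner a b (c # cs) = (case horner a b cs of (v, w) \<Rightarrow> (c * (b * w) + a * v, b * w))"

lemma horner_correct:
  assumes "b > 0"
  shows "case horner a b cs of (v, w) \<Rightarrow>
    w > 0 \<and> poly (int_poly_of (Poly cs)) (of_int a / of_int b :: real) = of_int v / of_int w"
proof (induction cs)
  case (Cons c cs)
  obtain v w where vw: "horner a b cs = (v, w)"
    by fastforce
  with Cons have IH: "w > 0" "poly (int_poly_of (Poly cs)) (of_int a / of_int b :: real) = of_int v / of_int w"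
    by simp_all
  have "int_poly_of (Poly (c # cs)) = pCons (of_int c :: real) (int_poly_of (Poly cs))"
    by (simp add: map_poly_pCons)
  then have "poly (int_poly_of (Poly (c # cs))) (of_int a / of_int b :: real)
      = of_int (c * (b * w) + a * v) / of_int (b * w)"
    using IH assms by (simp add: add_divide_distrib)
  then show ?case
    using IH(1) assms by (simp only: horner.simps vw prod.case) simp
qed simp

section \<open>Verification at the 41 nodes\<close>

lemma length_nodes: "length nodes = 41"
  by (simp add: nodes_def)

lemma nodes_pos: "list_all (\<lambda>(a, b). 0 < a \<and> 0 < b) nodes"
  by (simp add: nodes_def)

lemma nodes_sorted: "sorted_wrt (\<lambda>(a, b) (c, d). a * d < c * b) nodes"
  by code_simp

text \<open>The inequality between \<open>2 * x ^ 8\<close> and the signed value of the polynomial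
  at \<open>x = a / b\<close>, with the positive denominators \<open>w\<close> and
  \<open>b ^ 8\<close> cleared, is decided by computation.\<close>

lemma nodes_alternate:
  "list_all (\<lambda>(i, a, b). case horner a b base_coeffs of (v, w) \<Rightarrow>
      2 * a ^ 8 * w \<le> (- 1) ^ i * v * b ^ 8) (List.enumerate 0 nodes)"
  by code_simp

lemma node_pos:
  assumes "i \<le> 40"
  shows "fst (nodes ! i) > 0" "snd (nodes ! i) > 0"
  using nodes_pos assms length_nodes by (auto simp: list_all_length case_prod_unfold)

lemma node_strict_mono:
  assumes "i < j" "j \<le> 40"
  shows "node i < node j"
proof -
  have "fst (nodes ! i) * snd (nodes ! j) < fst (nodes ! j) * snd (nodes ! i)"
    using sorted_wrt_nth_less[OF nodes_sorted, of i j] assms length_nodes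
    by (simp add: case_prod_unfold)
  then have "real_of_int (fst (nodes ! i)) * of_int (snd (nodes ! j))
      < of_int (fst (nodes ! j)) * of_int (snd (nodes ! i))"
    by (simp flip: of_int_mult)
  then show ?thesis
    using node_pos[of i] node_pos[of j] assms by (simp add: node_def field_simps)
qed

lemma base_poly_alternates:
  assumes "i \<le> 40"
  shows "2 * node i ^ 8 \<le> (- 1) ^ i * poly (int_poly_of base_poly) (node i)"
proof -
  obtain a b where ab: "nodes ! i = (a, b)"
    by fastforce
  obtain v w where vw: "horner a b base_coeffs = (v, w)"
    by fastforce
  have "b > 0"
    using node_pos(2)[OF assms] ab by simp
  then have poly: "w > 0" "poly (int_poly_of base_poly) (of_int a / of_int b :: real) = of_int v / of_int w"
    using horner_correct[where a = a and b = b and cs = base_coeffs] by (simp_all add: vw base_poly_def)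
  have "2 * a ^ 8 * w \<le> (- 1) ^ i * v * b ^ 8"
    using nodes_alternate assms length_nodes
    by (auto simp: list_all_length nth_enumerate_eq ab vw dest!: spec[of _ i])
  then have "real_of_int (2 * a ^ 8 * w) \<le> of_int ((- 1) ^ i * v * b ^ 8)"
    by (simp only: of_int_le_iff)
  then have le: "2 * real_of_int a ^ 8 * of_int w \<le> (- 1) ^ i * of_int v * of_int b ^ 8"
    by simp
  have "2 * node i ^ 8 = 2 * real_of_int a ^ 8 * of_int w / (of_int w * of_int b ^ 8)"
    using poly(1) by (simp add: node_def ab power_divide)
  also have "\<dots> \<le> (- 1) ^ i * of_int v * of_int b ^ 8 / (of_int w * of_int b ^ 8)"
    using le poly(1) \<open>b > 0\<close> by (intro divide_right_mono) auto
  also have "\<dots> = (- 1) ^ i * poly (int_poly_of base_poly) (node i)"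
    using \<open>b > 0\<close> by (simp add: node_def ab poly(2))
  finally show ?thesis .
qed

lemma degree_base_poly: "degree base_poly = 40"
  by (simp add: base_poly_def base_coeffs_def)

theorem corollary3:
  shows "infinite {n :: nat. n > 0 \<and>
           (\<exists>\<alpha> :: complex. totally_positive \<alpha> \<and> alg_degree \<alpha> = n \<and>
              Re (alg_trace \<alpha>) < 2 * real n - 1 / 4 * (ln (ln (real n)) / ln (ln (ln (real n)))))}"
\<comment> \<open>The denominator \<open>x ^ 8\<close> is positive on the positive axis and has
  degree below 40; the coefficient -79 at index 39 gives trace 79, one less than twice the
  degree.\<close>
proof (rule infinite_small_trace_of_alternating[of base_poly 40 "monom 1 8" node])
  have Q: "poly (int_poly_of (monom 1 8)) x = x ^ 8" for x :: real
    by (simp add: map_poly_monom poly_monom)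
  show "2 * poly (int_poly_of (monom 1 8)) (node i) \<le> (- 1) ^ i * poly (int_poly_of base_poly) (node i)"
    if "i \<le> 40" for i
    using base_poly_alternates[OF that] by (simp only: Q)
  show node_0: "0 < node 0"
    using node_pos[of 0] by (simp add: node_def)
  show "poly (int_poly_of (monom 1 8)) x > 0" if "node 0 \<le> x" for x
    using that node_0 by (simp add: Q)
  show "degree (monom 1 8 :: int poly) < 40"
    using degree_monom_le[of "1 :: int" 8] by simp
  show "lead_coeff base_poly = 1" "- coeff base_poly (40 - 1) < 2 * int 40"
    unfolding degree_base_poly base_poly_def coeff_Poly_eq
    by (simp_all add: base_coeffs_def nth_default_def)
qed (simp_all add: degree_base_poly node_strict_mono)

end
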